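(* Let $f:[0,\infty)\to\mathbb{R}$ be a superquadratic function and let $\varphi:[0,\infty)\to\mathbb{R}$ be a function such that $f(y)\ge f(x)+\varphi(x)(y-x)+f(|y-x|)$ for all $x,y\ge0$. Let $x_1,\dots,x_n\ge 0$, let $(a_1,\dots,a_n)$ be a nonnegative $n$-tuple with $A_n=\sum_{i=1}^n a_i>0$, and let $\overline{x}=\frac{1}{A_n}\sum_{i=1}^n a_ix_i$. Then $$0\le\left|\frac{1}{A_n}\sum_{i=1}^n a_i\left|f(x_i)-f(\overline{x})-f(|\overline{x}-x_i|)\right|-\frac{1}{A_n}\sum_{i=1}^n a_i|\varphi(\overline{x})|\,|\overline{x}-x_i|\right|$$ $$\le\frac{1}{A_n}\sum_{i=1}^n a_if(x_i)-f(\overline{x})-\frac{1}{A_n}\sum_{i=1}^n a_if(|\overline{x}-x_i|).$$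
   Context: A function $f:[0,\infty)\to\mathbb{R}$ is superquadratic if for every $x\ge0$ there is a constant $C_x\in\mathbb{R}$ such that $f(y)\ge f(x)+C_x(y-x)+f(|y-x|)$ for all $y\ge0$; thus $\varphi(x)=C_x$ is a choice of such constants. *)

theory Defs
  imports Complex_Main
begin

text \<open>A real function on the half-line $[0,\infty)$ is represented by a total function on the reals;
  only its values at nonnegative arguments are ever referred to.\<close>

definition superquadratic :: "(real \<Rightarrow> real) \<Rightarrow> bool" where
  "superquadratic f \<longleftrightarrow>
     (\<forall>x\<ge>0. \<exists>C. \<forall>y\<ge>0. f y \<ge> f x + C * (y - x) + f \<bar>y - x\<bar>)"

end

theory Submission
  imports Defs
begin

text \<open>Put $u_i = f(x_i) - f(\overline{x}) - f(|\overline{x} - x_i|)$ and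
  $v_i = \varphi(\overline{x})(x_i - \overline{x})$. The hypothesis at $\overline{x}$ says
  $u_i - v_i \ge 0$, hence $u_i - v_i = |u_i - v_i| \ge ||u_i| - |v_i||$. Taking weighted means gives
  the claim, since the weighted mean of the $v_i$ vanishes.\<close>

theorem theorem15:
  fixes f \<phi> :: "real \<Rightarrow> real" and n :: nat and x a :: "nat \<Rightarrow> real" and A xbar :: real
  assumes "superquadratic f"
    and "\<forall>s\<ge>0. \<forall>t\<ge>0. f t \<ge> f s + \<phi> s * (t - s) + f \<bar>t - s\<bar>"
    and "\<forall>i\<in>{1..n}. x i \<ge> 0"
    and "\<forall>i\<in>{1..n}. a i \<ge> 0"
    and "A = (\<Sum>i=1..n. a i)"
    and "A > 0"
    and "xbar = (1 / A) * (\<Sum>i=1..n. a i * x i)"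
  shows "0 \<le> \<bar>(1 / A) * (\<Sum>i=1..n. a i * \<bar>f (x i) - f xbar - f \<bar>xbar - x i\<bar>\<bar>)
              - (1 / A) * (\<Sum>i=1..n. a i * \<bar>\<phi> xbar\<bar> * \<bar>xbar - x i\<bar>)\<bar>
    \<and> \<bar>(1 / A) * (\<Sum>i=1..n. a i * \<bar>f (x i) - f xbar - f \<bar>xbar - x i\<bar>\<bar>)
              - (1 / A) * (\<Sum>i=1..n. a i * \<bar>\<phi> xbar\<bar> * \<bar>xbar - x i\<bar>)\<bar>
      \<le> (1 / A) * (\<Sum>i=1..n. a i * f (x i)) - f xbar
         - (1 / A) * (\<Sum>i=1..n. a i * f \<bar>xbar - x i\<bar>)"
proof -
  define u where "u = (\<lambda>i. f (x i) - f xbar - f \<bar>xbar - x i\<bar>)"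
  define v where "v = (\<lambda>i. \<phi> xbar * (x i - xbar))"
  have mean: "(\<Sum>i=1..n. a i * x i) = A * xbar"
    using assms(6,7) by simp
  \<comment> \<open>Nonnegativity makes \<open>xbar\<close> admissible as the base point
    \<open>s\<close> in the hypothesis on \<open>\<phi>\<close>.\<close>
  have "xbar \<ge> 0"
    using assms(3,4,6,7) by (auto intro!: mult_nonneg_nonneg divide_nonneg_pos sum_nonneg)
  \<comment> \<open>Instance \<open>s = xbar\<close>, \<open>t = x i\<close>; commuting the
    difference under the absolute value matches the argument of \<open>f\<close> in
    \<open>u\<close>.\<close>
  then have le: "v i \<le> u i" if "i \<in> {1..n}" for i
    using assms(2,3) that unfolding u_def v_def abs_minus_commute[of xbar] by fastforce
  \<comment> \<open>Factored so that both terms in the bracket equal \<open>A * xbar\<close> and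
    cancel.\<close>
  have "(\<Sum>i=1..n. a i * v i) = \<phi> xbar * ((\<Sum>i=1..n. a i * x i) - (\<Sum>i=1..n. a i) * xbar)"
    unfolding v_def by (simp add: sum_distrib_left sum_distrib_right sum_subtractf algebra_simps)
  then have v0: "(\<Sum>i=1..n. a i * v i) = 0"
    using mean assms(5) by simp
  \<comment> \<open>The estimate runs on unnormalised sums; division by \<open>A\<close> comes at
    the end.\<close>
  have "\<bar>(\<Sum>i=1..n. a i * \<bar>u i\<bar>) - (\<Sum>i=1..n. a i * \<bar>v i\<bar>)\<bar>
      = \<bar>\<Sum>i=1..n. a i * (\<bar>u i\<bar> - \<bar>v i\<bar>)\<bar>"
    by (simp add: sum_subtractf right_diff_distrib)
  also have "\<dots> \<le> (\<Sum>i=1..n. \<bar>a i * (\<bar>u i\<bar> - \<bar>v i\<bar>)\<bar>)"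
    by (rule sum_abs)
  also have "\<dots> \<le> (\<Sum>i=1..n. a i * (u i - v i))"
  proof (rule sum_mono)
    fix i assume i: "i \<in> {1..n}"
    \<comment> \<open>Reverse triangle inequality, where \<open>le\<close> removes the absolute
      value around \<open>u i - v i\<close>.\<close>
    have "\<bar>\<bar>u i\<bar> - \<bar>v i\<bar>\<bar> \<le> u i - v i"
      using le[OF i] by linarith
    then show "\<bar>a i * (\<bar>u i\<bar> - \<bar>v i\<bar>)\<bar> \<le> a i * (u i - v i)"
      using assms(4) i by (simp add: abs_mult mult_left_mono)
  qed
  also have "\<dots> = (\<Sum>i=1..n. a i * u i)"
    using v0 by (simp add: sum_subtractf right_diff_distrib)
  finally have "\<bar>(\<Sum>i=1..n. a i * \<bar>u i\<bar>) - (\<Sum>i=1..n. a i * \<bar>v i\<bar>)\<bar> / A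
      \<le> (\<Sum>i=1..n. a i * u i) / A"
    using assms(6) by (simp add: divide_right_mono)
  moreover have "\<bar>(\<Sum>i=1..n. a i * \<bar>u i\<bar>) - (\<Sum>i=1..n. a i * \<bar>v i\<bar>)\<bar> / A
      = \<bar>(1 / A) * (\<Sum>i=1..n. a i * \<bar>u i\<bar>) - (1 / A) * (\<Sum>i=1..n. a i * \<bar>v i\<bar>)\<bar>"
    using assms(6) by (simp flip: diff_divide_distrib)
  moreover have "a i * \<bar>v i\<bar> = a i * \<bar>\<phi> xbar\<bar> * \<bar>xbar - x i\<bar>" for i
    by (simp add: v_def abs_mult abs_minus_commute)
  \<comment> \<open>The weights sum to \<open>A\<close>, so the constant \<open>f xbar\<close>
    contributes \<open>A * f xbar\<close>, which division by \<open>A\<close> turns back into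
    \<open>f xbar\<close>.\<close>
  moreover have "(\<Sum>i=1..n. a i * u i) = (\<Sum>i=1..n. a i * f (x i)) - A * f xbar
      - (\<Sum>i=1..n. a i * f \<bar>xbar - x i\<bar>)"
    by (simp add: u_def assms(5) right_diff_distrib sum_subtractf sum_distrib_right)
  then have "(\<Sum>i=1..n. a i * u i) / A = (1 / A) * (\<Sum>i=1..n. a i * f (x i)) - f xbar
      - (1 / A) * (\<Sum>i=1..n. a i * f \<bar>xbar - x i\<bar>)"
    using assms(6) by (simp add: diff_divide_distrib)
  ultimately show ?thesis
    by (simp add: u_def)
qed

end
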